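(* Let $M = (m_{ij})$ be an $m \times n$ $(0,1)$-matrix with row sums $r_1,\ldots,r_m$ and column sums $c_1,\ldots,c_n$. If for fixed integers $a$ and $b$ (and fixed positive integers $k_1,k_2$) there are matrices $A_i \in \mathrm{CGW}(r_i,a;k_1)$ and $B_j \in \mathrm{CGW}(c_j,b;k_2)$ for all $1 \le i \le m$ and $1 \le j \le n$, then there is a $\mathrm{CGW}(\sigma(M),ab;k)$, where \[ \sigma(M) = \sum_{i=1}^{m} r_i = \sum_{j=1}^{n} c_j \] and $k = \mathrm{lcm}(k_1,k_2)$.
   Context: For a positive integer $k$, let $\zeta_k = e^{2\pi\sqrt{-1}/k}$ and $\mathcal{U}_k = \{0\} \cup \{\zeta_k^j : 0 \le j \le k-1\}$. $\mathrm{CGW}(n,w;k)$ denotes the set of complex generalized weighing matrices of order $n$ and weight $w$: the $n \times n$ matrices $W$ with entries in $\mathcal{U}_k$ such that $WW^{*} = wI_n$, where $W^*$ is the complex conjugate transpose. (Orders and weights are positive integers.) *)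

theory Defs
  imports Complex_Main "Jordan_Normal_Form.Schur_Decomposition"
begin

definition zeta :: "nat \<Rightarrow> complex" where
  "zeta k = exp (2 * of_real pi * \<i> / of_nat k)"

definition unit_roots0 :: "nat \<Rightarrow> complex set" where
  "unit_roots0 k = {0} \<union> {zeta k ^ j | j. j < k}"

text \<open>Order, weight and the parameter \<open>k\<close> are positive by convention, so the set is empty
  if one of them is zero.\<close>

definition CGW :: "nat \<Rightarrow> nat \<Rightarrow> nat \<Rightarrow> complex mat set" where
  "CGW n w k = {W. 0 < n \<and> 0 < w \<and> 0 < k \<and> W \<in> carrier_mat n n \<and>
     elements_mat W \<subseteq> unit_roots0 k \<and>
     W * mat_adjoint W = of_nat w \<cdot>\<^sub>m 1\<^sub>m n}"

definition zero_one_mat :: "nat mat \<Rightarrow> bool" where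
  "zero_one_mat M \<longleftrightarrow> elements_mat M \<subseteq> {0, 1}"

text \<open>Rows and columns are numbered from \<open>0\<close>.\<close>

definition row_sum :: "nat mat \<Rightarrow> nat \<Rightarrow> nat" where
  "row_sum M i = (\<Sum>j<dim_col M. M $$ (i, j))"

definition col_sum :: "nat mat \<Rightarrow> nat \<Rightarrow> nat" where
  "col_sum M j = (\<Sum>i<dim_row M. M $$ (i, j))"

definition sigma :: "nat mat \<Rightarrow> nat" where
  "sigma M = (\<Sum>i<dim_row M. row_sum M i)"

end

theory Submission
  imports Defs
begin

text \<open>Let \<open>S\<close> be the set of positions of the ones in \<open>M\<close>, and index square matrices of order
  \<open>\<sigma>(M)\<close> by \<open>S\<close>. The direct sum \<open>U\<close> of the \<open>A\<^sub>i\<close>, grouped by rows of \<open>M\<close>, satisfies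
  \<open>U U\<^sup>* = a I\<close>, and the direct sum \<open>V\<close> of the \<open>B\<^sub>j\<close>, grouped by columns, satisfies \<open>V V\<^sup>* = b I\<close>.
  So \<open>W = U V\<close> satisfies \<open>W W\<^sup>* = ab I\<close>. A row and a column of \<open>M\<close> meet in at most one element
  of \<open>S\<close>, so every entry of \<open>W\<close> is zero or a single product of an entry of some \<open>A\<^sub>i\<close> and an entry
  of some \<open>B\<^sub>j\<close>, and hence lies in \<open>\<U>\<^sub>k\<close>.\<close>

text \<open>The index set is arbitrary, so a block can be indexed directly by the ones in a row or
  column of \<open>M\<close>. Positivity of order, weight and \<open>k\<close> is left out here and
  supplied when passing back to \<open>CGW\<close>.\<close>

definition cgw_on :: "'a set \<Rightarrow> nat \<Rightarrow> nat \<Rightarrow> ('a \<Rightarrow> 'a \<Rightarrow> complex) \<Rightarrow> bool" where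
  "cgw_on T w k f \<longleftrightarrow> (\<forall>p\<in>T. \<forall>q\<in>T. f p q \<in> unit_roots0 k) \<and>
     (\<forall>p\<in>T. \<forall>r\<in>T. (\<Sum>q\<in>T. f p q * cnj (f r q)) = (if p = r then of_nat w else 0))"

lemma mem_CGW_iff:
  "W \<in> CGW n w k \<longleftrightarrow> 0 < n \<and> 0 < w \<and> 0 < k \<and> W \<in> carrier_mat n n \<and>
     cgw_on {..<n} w k (\<lambda>i j. W $$ (i, j))"
proof (cases "W \<in> carrier_mat n n")
  case True
  have entry: "(W * mat_adjoint W) $$ (i, j) = (\<Sum>q<n. W $$ (i, q) * cnj (W $$ (j, q)))"
    if "i < n" "j < n" for i j
    using True that
    by (auto simp: mat_adjoint_def scalar_prod_def mat_of_rows_def atLeast0LessThan intro!: sum.cong)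
  have "W * mat_adjoint W = of_nat w \<cdot>\<^sub>m 1\<^sub>m n \<longleftrightarrow>
      (\<forall>i<n. \<forall>j<n. (W * mat_adjoint W) $$ (i, j) = (of_nat w \<cdot>\<^sub>m 1\<^sub>m n) $$ (i, j))"
    using True by (auto simp: mat_adjoint_def mat_eq_iff)
  moreover have "elements_mat W \<subseteq> unit_roots0 k \<longleftrightarrow> (\<forall>i<n. \<forall>j<n. W $$ (i, j) \<in> unit_roots0 k)"
    using True by (fastforce simp: elements_mat_def)
  ultimately show ?thesis
    using True entry by (auto simp: CGW_def cgw_on_def)
qed (simp add: CGW_def)

text \<open>One bijection relabels rows and columns alike: it only permutes the terms of each inner
  product, and injectivity keeps diagonal and off-diagonal pairs apart.\<close>

lemma cgw_on_reindex:
  assumes h: "bij_betw h T T'" and f: "cgw_on T' w k f"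
  shows "cgw_on T w k (\<lambda>p q. f (h p) (h q))"
proof -
  have "(\<Sum>q\<in>T. f (h p) (h q) * cnj (f (h r) (h q))) = (\<Sum>q\<in>T'. f (h p) q * cnj (f (h r) q))"
    for p r
    by (rule sum.reindex_bij_betw[OF h])
  with f show ?thesis
    using bij_betw_apply[OF h] inj_on_eq_iff[OF bij_betw_imp_inj_on[OF h]]
    by (simp add: cgw_on_def)
qed

lemma CGW_imp_cgw_on:
  assumes "W \<in> CGW (card T) w k" and "finite T"
  shows "\<exists>f. cgw_on T w k f"
proof -
  obtain h where "bij_betw h T {..<card T}"
    using ex_bij_betw_finite_nat[OF assms(2)] by (auto simp: atLeast0LessThan)
  with assms(1) show ?thesis
    using cgw_on_reindex by (fastforce simp: mem_CGW_iff)
qed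

lemma cgw_on_imp_CGW:
  assumes f: "cgw_on T w k f" and "finite T" and "0 < card T" "0 < w" "0 < k"
  shows "\<exists>W. W \<in> CGW (card T) w k"
proof -
  obtain h where "bij_betw h {..<card T} T"
    using ex_bij_betw_nat_finite[OF assms(2)] by (auto simp: atLeast0LessThan)
  from cgw_on_reindex[OF this f]
  have "cgw_on {..<card T} w k (\<lambda>i j. f (h i) (h j))" .
  then have "mat (card T) (card T) (\<lambda>(i, j). f (h i) (h j)) \<in> CGW (card T) w k"
    using assms by (simp add: mem_CGW_iff cgw_on_def)
  then show ?thesis ..
qed

text \<open>The equation \<open>x ^ k = 1\<close> passes to multiples of \<open>k\<close> and to
  products, which makes it the convenient form for the \<open>lcm\<close>.\<close>

lemma mem_unit_roots0_iff:
  assumes "0 < k"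
  shows "x \<in> unit_roots0 k \<longleftrightarrow> x = 0 \<or> x ^ k = 1"
proof -
  have z: "zeta k ^ j = cis (2 * pi * real j / real k)" for j
    using assms by (simp add: zeta_def cis_conv_exp flip: exp_of_nat_mult) (simp add: field_simps)
  have "{zeta k ^ j | j. j < k} = {x. x ^ k = 1}"
    using bij_betw_imp_surj_on[OF bij_betw_roots_unity[OF assms]] by (auto simp: z)
  then show ?thesis
    by (auto simp: unit_roots0_def)
qed

lemma mult_mem_unit_roots0_lcm:
  assumes "0 < k" "0 < l" and x: "x \<in> unit_roots0 k" and y: "y \<in> unit_roots0 l"
  shows "x * y \<in> unit_roots0 (lcm k l)"
proof -
  have "x ^ lcm k l = 1" if "x ^ k = 1"
    using that dvd_lcm1[of k l] by (auto simp: dvd_def power_mult)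
  moreover have "y ^ lcm k l = 1" if "y ^ l = 1"
    using that dvd_lcm2[of l k] by (auto simp: dvd_def power_mult)
  ultimately show ?thesis
    using assms by (auto simp: mem_unit_roots0_iff lcm_pos_nat power_mult_distrib)
qed

text \<open>\<open>U\<close> has the entry \<open>\<alpha> i j j'\<close> in row
  \<open>(i, j)\<close> and column \<open>(i, j')\<close>; \<open>V\<close> has
  \<open>\<beta> j' i i'\<close> in row \<open>(i, j')\<close> and column \<open>(i', j')\<close>.
  Between \<open>(i, j)\<close> and \<open>(i', j')\<close> the product \<open>U V\<close> can pass
  only through \<open>(i, j')\<close>, so its entries are those of \<open>?F\<close>.\<close>

lemma cgw_on_combine:
  fixes S :: "('a \<times> 'b) set"
  assumes "finite S" and k: "0 < k\<^sub>1" "0 < k\<^sub>2"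
    and \<alpha>: "\<And>i. i \<in> Domain S \<Longrightarrow> cgw_on (S `` {i}) a k\<^sub>1 (\<alpha> i)"
    and \<beta>: "\<And>j. j \<in> Range S \<Longrightarrow> cgw_on (S\<inverse> `` {j}) b k\<^sub>2 (\<beta> j)"
  shows "cgw_on S (a * b) (lcm k\<^sub>1 k\<^sub>2)
    (\<lambda>(i, j) (i', j'). if (i, j') \<in> S then \<alpha> i j j' * \<beta> j' i i' else 0)"
    (is "cgw_on _ _ _ ?F")
  unfolding cgw_on_def
proof (intro conjI ballI)
  fix p q assume "p \<in> S" "q \<in> S"
  obtain i j i' j' where pq: "p = (i, j)" "q = (i', j')"
    by (metis surj_pair)
  have "\<alpha> i j j' * \<beta> j' i i' \<in> unit_roots0 (lcm k\<^sub>1 k\<^sub>2)" if "(i, j') \<in> S"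
  proof (intro mult_mem_unit_roots0_lcm k)
    show "\<alpha> i j j' \<in> unit_roots0 k\<^sub>1"
      using \<alpha>[OF DomainI[OF that]] \<open>p \<in> S\<close> that by (simp add: cgw_on_def pq)
    show "\<beta> j' i i' \<in> unit_roots0 k\<^sub>2"
      using \<beta>[OF RangeI[OF that]] \<open>q \<in> S\<close> that by (simp add: cgw_on_def pq)
  qed
  moreover have "0 \<in> unit_roots0 (lcm k\<^sub>1 k\<^sub>2)"
    by (simp add: unit_roots0_def)
  ultimately show "?F p q \<in> unit_roots0 (lcm k\<^sub>1 k\<^sub>2)"
    by (simp add: pq)
next
  fix p r assume "p \<in> S" "r \<in> S"
  obtain i j i' j' where pr: "p = (i, j)" "r = (i', j')"
    by (metis surj_pair)
  have S: "(i, j) \<in> S" "(i', j') \<in> S"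
    using \<open>p \<in> S\<close> \<open>r \<in> S\<close> pr by auto
  have fin: "finite (Range S)" "finite (S `` {i})" "\<And>y. finite (S\<inverse> `` {y})"
    using \<open>finite S\<close> by (auto simp: finite_Range)
  \<comment> \<open>Grouping the sum by columns lets the orthogonality of each
    \<open>\<beta> y\<close> act first, as \<open>V\<close> times its adjoint collapses inside
    \<open>U V\<close> times its adjoint.\<close>
  have "(\<Sum>q\<in>S. ?F p q * cnj (?F r q)) = (\<Sum>(y, x)\<in>S\<inverse>. ?F p (x, y) * cnj (?F r (x, y)))"
    by (rule sum.reindex_bij_witness[of _ prod.swap prod.swap]) auto
  also have "S\<inverse> = (SIGMA y:Range S. S\<inverse> `` {y})"
    by auto
  also have "(\<Sum>(y, x)\<in>\<dots>. ?F p (x, y) * cnj (?F r (x, y))) =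
      (\<Sum>y\<in>Range S. \<Sum>x\<in>S\<inverse> `` {y}. ?F p (x, y) * cnj (?F r (x, y)))"
    using fin by (subst sum.Sigma) auto
  also have "\<dots> = (\<Sum>y\<in>Range S. if (i, y) \<in> S \<and> i = i' then
      \<alpha> i j y * cnj (\<alpha> i j' y) * of_nat b else 0)"
  proof (rule sum.cong[OF refl])
    fix y assume "y \<in> Range S"
    show "(\<Sum>x\<in>S\<inverse> `` {y}. ?F p (x, y) * cnj (?F r (x, y))) =
      (if (i, y) \<in> S \<and> i = i' then \<alpha> i j y * cnj (\<alpha> i j' y) * of_nat b else 0)"
    \<comment> \<open>If both pairs lie in \<open>S\<close>, then \<open>i\<close> and
      \<open>i'\<close> index rows of the block \<open>\<beta> y\<close>; otherwise every term has a
      zero factor.\<close>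
    proof (cases "(i, y) \<in> S \<and> (i', y) \<in> S")
      case True
      then have "(\<Sum>x\<in>S\<inverse> `` {y}. ?F p (x, y) * cnj (?F r (x, y))) =
          \<alpha> i j y * cnj (\<alpha> i' j' y) * (\<Sum>x\<in>S\<inverse> `` {y}. \<beta> y i x * cnj (\<beta> y i' x))"
        by (simp add: pr sum_distrib_left mult_ac)
      also have "(\<Sum>x\<in>S\<inverse> `` {y}. \<beta> y i x * cnj (\<beta> y i' x)) = (if i = i' then of_nat b else 0)"
        using \<beta>[OF \<open>y \<in> Range S\<close>] True by (simp add: cgw_on_def)
      finally show ?thesis
        using True by simp
    qed (auto simp: pr)
  qed
  \<comment> \<open>The surviving columns \<open>y\<close> form the index set of
    \<open>\<alpha> i\<close>, which leaves an inner product of its rows \<open>j\<close> and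
    \<open>j'\<close>. For \<open>i = i'\<close>, equality of \<open>p\<close> and \<open>r\<close>
    is equality of \<open>j\<close> and \<open>j'\<close>.\<close>
  also have "\<dots> = (if i = i' then (\<Sum>y\<in>S `` {i}. \<alpha> i j y * cnj (\<alpha> i j' y)) * of_nat b else 0)"
    using fin by (auto simp: sum_distrib_right intro!: sum.mono_neutral_cong_right split: if_splits)
  also have "\<dots> = (if p = r then of_nat (a * b) else 0)"
    using \<alpha>[OF DomainI[OF S(1)]] S by (cases "i = i'") (simp_all add: cgw_on_def pr)
  finally show "(\<Sum>q\<in>S. ?F p q * cnj (?F r q)) = (if p = r then of_nat (a * b) else 0)" .
qed

theorem theorem3p17:
  fixes M :: "nat mat" and m n a b k\<^sub>1 k\<^sub>2 :: nat
    and A B :: "nat \<Rightarrow> complex mat"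
  assumes "0 < m" and "0 < n" and "0 < k\<^sub>1" and "0 < k\<^sub>2"
    and "M \<in> carrier_mat m n" and "zero_one_mat M"
    and "\<And>i. i < m \<Longrightarrow> A i \<in> CGW (row_sum M i) a k\<^sub>1"
    and "\<And>j. j < n \<Longrightarrow> B j \<in> CGW (col_sum M j) b k\<^sub>2"
  shows "sigma M = (\<Sum>j<n. col_sum M j) \<and>
    (\<exists>W. W \<in> CGW (sigma M) (a * b) (lcm k\<^sub>1 k\<^sub>2))"
proof
  have dim: "dim_row M = m" "dim_col M = n"
    using assms(5) by auto
  show "sigma M = (\<Sum>j<n. col_sum M j)"
    unfolding sigma_def row_sum_def col_sum_def dim by (rule sum.swap)
  define S where "S = {(i, j). i < m \<and> j < n \<and> M $$ (i, j) = 1}"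
  have "S \<subseteq> {..<m} \<times> {..<n}"
    by (auto simp: S_def)
  then have "finite S"
    by (rule finite_subset) simp
  have M01: "M $$ (i, j) = (if (i, j) \<in> S then 1 else 0)" if "i < m" "j < n" for i j
    using elements_matI[OF assms(5) that refl] assms(6) that by (auto simp: zero_one_mat_def S_def)
  have row: "row_sum M i = card (S `` {i})" if "i < m" for i
  proof -
    have "row_sum M i = (\<Sum>j<n. if (i, j) \<in> S then 1 else 0)"
      using that by (simp add: row_sum_def dim M01)
    also have "\<dots> = card ({..<n} \<inter> {j. (i, j) \<in> S})"
      by (simp add: sum.If_cases)
    also have "{..<n} \<inter> {j. (i, j) \<in> S} = S `` {i}"
      by (auto simp: S_def)
    finally show ?thesis .
  qed
  have col: "col_sum M j = card (S\<inverse> `` {j})" if "j < n" for j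
  proof -
    have "col_sum M j = (\<Sum>i<m. if (i, j) \<in> S then 1 else 0)"
      using that by (simp add: col_sum_def dim M01)
    also have "\<dots> = card ({..<m} \<inter> {i. (i, j) \<in> S})"
      by (simp add: sum.If_cases)
    also have "{..<m} \<inter> {i. (i, j) \<in> S} = S\<inverse> `` {j}"
      by (auto simp: S_def)
    finally show ?thesis .
  qed
  have "S = (SIGMA i:{..<m}. S `` {i})"
    by (auto simp: S_def)
  then have "card S = (\<Sum>i<m. card (S `` {i}))"
    using \<open>finite S\<close> by (metis card_SigmaI finite_Image finite_lessThan)
  then have sigma: "sigma M = card S"
    by (simp add: sigma_def dim row)
  \<comment> \<open>Orders and weights in \<open>CGW\<close> are positive. Row 0 therefore contains
    a one, so \<open>S\<close> is nonempty and the new order is positive.\<close>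
  have "0 < row_sum M 0" "0 < a" "0 < b"
    using assms(7)[OF \<open>0 < m\<close>] assms(8)[OF \<open>0 < n\<close>] by (auto simp: CGW_def)
  then have "0 < card S"
    using row[OF \<open>0 < m\<close>] \<open>finite S\<close> by (auto simp: card_gt_0_iff)
  \<comment> \<open>Each \<open>A i\<close> is carried to the columns where row \<open>i\<close> has
    its ones. The choice of bijection is immaterial, since combining the blocks uses no order on the
    indices.\<close>
  have "\<exists>f. cgw_on (S `` {i}) a k\<^sub>1 f" if "i \<in> Domain S" for i
  proof -
    have "i < m"
      using that by (auto simp: S_def)
    from CGW_imp_cgw_on[OF assms(7)[OF this, unfolded row[OF this]]] show ?thesis
      using \<open>finite S\<close> by simp
  qed
  then obtain \<alpha> where \<alpha>: "\<And>i. i \<in> Domain S \<Longrightarrow> cgw_on (S `` {i}) a k\<^sub>1 (\<alpha> i)"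
    by metis
  have "\<exists>f. cgw_on (S\<inverse> `` {j}) b k\<^sub>2 f" if "j \<in> Range S" for j
  proof -
    have "j < n"
      using that by (auto simp: S_def)
    from CGW_imp_cgw_on[OF assms(8)[OF this, unfolded col[OF this]]] show ?thesis
      using \<open>finite S\<close> by simp
  qed
  then obtain \<beta> where \<beta>: "\<And>j. j \<in> Range S \<Longrightarrow> cgw_on (S\<inverse> `` {j}) b k\<^sub>2 (\<beta> j)"
    by metis
  show "\<exists>W. W \<in> CGW (sigma M) (a * b) (lcm k\<^sub>1 k\<^sub>2)"
    unfolding sigma
    using cgw_on_imp_CGW[OF cgw_on_combine[OF \<open>finite S\<close> assms(3,4) \<alpha> \<beta>] \<open>finite S\<close> \<open>0 < card S\<close>]
      \<open>0 < a\<close> \<open>0 < b\<close> assms(3,4) by (simp add: lcm_pos_nat)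
qed

end
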